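(* Let $A$ be a finite set with cardinality greater than one, and let $FQ[A]$ be the free quandle generated by $A$. Then each connected component of $FQ[A]$ with the inner metric $d^{\mathrm{Inn}}_A$ is quasi-isometric to a tree.
   Context: A quandle is a non-empty set $X$ with a binary operation $\triangleleft$ such that (i) $x \triangleleft x = x$ for all $x$; (ii) for every $y \in X$ the map $s_y \colon X \to X$, $s_y(x) = x \triangleleft y$, is a bijection (the point symmetry at $y$); (iii) $(x \triangleleft y)\triangleleft z = (x \triangleleft z)\triangleleft (y \triangleleft z)$ for all $x,y,z$. $\mathrm{Aut}(X)$ is the group of bijective quandle homomorphisms $X\to X$ with product $fg := g \circ f$, acting on $X$ from the right by $x\cdot f := f(x)$. $\mathrm{Inn}(X)$ is the subgroup generated by $\{s_y \mid y \in X\}$. A connected component of $X$ is an orbit of $\mathrm{Inn}(X)$. Free quandle: let $F[A]$ be the free group on the set $A$. On $A \times F[A]$ define $(a,w)\sim(b,v)$ if $a=b$ and $w = a^n v$ in $F[A]$ for some $n \in \mathbb{Z}$. Let $FQ[A] = (A\times F[A])/{\sim}$, and write $a^w$ for the class of $(a,w)$. The free quandle on $A$ is $FQ[A]$ with $a^w \triangleleft b^v := a^{wv^{-1}bv}$. The elements $a^1$ ($a \in A$) generate $FQ[A]$, and $A$ is identified with the generating set $\{s_{a^1} \mid a \in A\}$ of $\mathrm{Inn}(FQ[A])$. For a generating set $S$ of $\mathrm{Inn}(X)$, consider the undirected graph with vertex set $X$ in which $x,y$ are joined by an edge if $y = x\cdot s$ for some $s \in S\cup S^{-1}$. Its connected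 components are the connected components of $X$; the inner metric $d^{\mathrm{Inn}}_S$ on a connected component is the path metric of this graph (edges have length one). Here $d^{\mathrm{Inn}}_A$ is the inner metric for the generating set identified with $A$. A tree is regarded as a metric space with its path metric. *)

theory Defs
  imports
    Complex_Main
    "HOL-Algebra.Group_Action"
    "HOL-Algebra.Generated_Groups"
begin

section \<open>Quandles and their automorphism groups\<close>

locale quandle =
  fixes X :: "'q set" and tri :: "'q \<Rightarrow> 'q \<Rightarrow> 'q" (infixl \<open>\<triangleleft>\<close> 70)
  assumes nonempty: "X \<noteq> {}"
    and idem: "x \<in> X \<Longrightarrow> x \<triangleleft> x = x"
    and bij: "y \<in> X \<Longrightarrow> bij_betw (\<lambda>x. x \<triangleleft> y) X X"
    and distrib: "\<lbrakk>x \<in> X; y \<in> X; z \<in> X\<rbrakk> \<Longrightarrow> (x \<triangleleft> y) \<triangleleft> z = (x \<triangleleft> z) \<triangleleft> (y \<triangleleft> z)"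

text \<open>Self-maps of \<open>X\<close> are kept extensional, so that equal maps on \<open>X\<close> are equal functions.\<close>

definition point_symmetry :: "'q set \<Rightarrow> ('q \<Rightarrow> 'q \<Rightarrow> 'q) \<Rightarrow> 'q \<Rightarrow> 'q \<Rightarrow> 'q" where
  "point_symmetry X tri y = (\<lambda>x\<in>X. tri x y)"

text \<open>The product of \<open>f\<close> and \<open>g\<close> is \<open>g \<circ> f\<close>: automorphisms act from the right.\<close>

definition quandle_Aut :: "'q set \<Rightarrow> ('q \<Rightarrow> 'q \<Rightarrow> 'q) \<Rightarrow> ('q \<Rightarrow> 'q) monoid" where
  "quandle_Aut X tri =
    \<lparr>carrier = {f \<in> Bij X. \<forall>x\<in>X. \<forall>y\<in>X. f (tri x y) = tri (f x) (f y)},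
     mult = (\<lambda>f g. compose X g f),
     one = (\<lambda>x\<in>X. x)\<rparr>"

definition quandle_Inn :: "'q set \<Rightarrow> ('q \<Rightarrow> 'q \<Rightarrow> 'q) \<Rightarrow> ('q \<Rightarrow> 'q) monoid" where
  "quandle_Inn X tri = subgroup_generated (quandle_Aut X tri) (point_symmetry X tri ` X)"

definition quandle_components :: "'q set \<Rightarrow> ('q \<Rightarrow> 'q \<Rightarrow> 'q) \<Rightarrow> 'q set set" where
  "quandle_components X tri = orbits (quandle_Inn X tri) X (\<lambda>f. f)"


section \<open>Graphs, trees and path metrics\<close>

text \<open>An undirected graph is given by a vertex set \<open>V\<close> and a symmetric adjacency relation \<open>E\<close>.\<close>

text \<open>The value is meaningful only for vertices \<open>x\<close> and \<open>y\<close> joined by a path.\<close>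

definition path_metric :: "('v \<times> 'v) set \<Rightarrow> 'v \<Rightarrow> 'v \<Rightarrow> real" where
  "path_metric E x y = real (LEAST n. (x, y) \<in> E ^^ n)"

text \<open>The list \<open>[x\<^sub>0, \<dots>, x\<^sub>n\<^sub>-\<^sub>1]\<close> stands for the closed path through \<open>x\<^sub>0, \<dots>, x\<^sub>n\<^sub>-\<^sub>1, x\<^sub>0\<close>.\<close>

definition graph_cycle :: "('v \<times> 'v) set \<Rightarrow> 'v list \<Rightarrow> bool" where
  "graph_cycle E xs \<longleftrightarrow> length xs \<ge> 3 \<and> distinct xs \<and>
     (\<forall>i<length xs. (xs ! i, xs ! (Suc i mod length xs)) \<in> E)"

definition tree :: "'v set \<Rightarrow> ('v \<times> 'v) set \<Rightarrow> bool" where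
  "tree V E \<longleftrightarrow> V \<noteq> {} \<and> E \<subseteq> V \<times> V \<and> sym E \<and> irrefl E \<and>
     (\<forall>x\<in>V. \<forall>y\<in>V. (x, y) \<in> E\<^sup>*) \<and> (\<nexists>xs. graph_cycle E xs)"

definition inner_graph ::
  "'q set \<Rightarrow> ('q \<Rightarrow> 'q \<Rightarrow> 'q) \<Rightarrow> ('q \<Rightarrow> 'q) set \<Rightarrow> ('q \<times> 'q) set" where
  "inner_graph X tri S =
     {(x, y). x \<in> X \<and> (\<exists>s \<in> S \<union> m_inv (quandle_Inn X tri) ` S. y = s x)}"

text \<open>Paths in the inner graph do not leave a connected component, so this restricts to the
  path metric of each component.\<close>

definition inner_metric ::
  "'q set \<Rightarrow> ('q \<Rightarrow> 'q \<Rightarrow> 'q) \<Rightarrow> ('q \<Rightarrow> 'q) set \<Rightarrow> 'q \<Rightarrow> 'q \<Rightarrow> real" where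
  "inner_metric X tri S = path_metric (inner_graph X tri S)"

definition quasi_isometric ::
  "'x set \<Rightarrow> ('x \<Rightarrow> 'x \<Rightarrow> real) \<Rightarrow> 'y set \<Rightarrow> ('y \<Rightarrow> 'y \<Rightarrow> real) \<Rightarrow> bool" where
  "quasi_isometric M d M' d' \<longleftrightarrow>
     (\<exists>f \<in> M \<rightarrow> M'. \<exists>L\<ge>1. \<exists>C\<ge>0.
        (\<forall>x\<in>M. \<forall>y\<in>M. d x y / L - C \<le> d' (f x) (f y) \<and> d' (f x) (f y) \<le> L * d x y + C) \<and>
        (\<forall>z\<in>M'. \<exists>x\<in>M. d' z (f x) \<le> C))"


section \<open>Free groups\<close>

text \<open>The letters \<open>(a, True)\<close> and \<open>(a, False)\<close> stand for \<open>a\<close> and its inverse. Elements of the free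
  group are the reduced words; a product is reduced by pushing the letters of the left factor, from
  right to left, onto the right factor.\<close>

type_synonym 'a fg_word = "('a \<times> bool) list"

definition inv_letter :: "'a \<times> bool \<Rightarrow> 'a \<times> bool" where
  "inv_letter x = (fst x, \<not> snd x)"

fun fg_reduced :: "'a fg_word \<Rightarrow> bool" where
  "fg_reduced (x # y # ys) \<longleftrightarrow> y \<noteq> inv_letter x \<and> fg_reduced (y # ys)"
| "fg_reduced _ \<longleftrightarrow> True"

fun fg_push :: "'a \<times> bool \<Rightarrow> 'a fg_word \<Rightarrow> 'a fg_word" where
  "fg_push x [] = [x]"
| "fg_push x (y # ys) = (if y = inv_letter x then ys else x # y # ys)"

definition free_group :: "'a set \<Rightarrow> 'a fg_word monoid" where
  "free_group A =
    \<lparr>carrier = {w. fg_reduced w \<and> fst ` set w \<subseteq> A},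
     mult = (\<lambda>u v. foldr fg_push u v),
     one = []\<rparr>"

definition fg_gen :: "'a \<Rightarrow> 'a fg_word" where
  "fg_gen a = [(a, True)]"


section \<open>Free quandles\<close>

definition fq_rel :: "'a set \<Rightarrow> (('a \<times> 'a fg_word) \<times> ('a \<times> 'a fg_word)) set" where
  "fq_rel A = {((a, w), (b, v)). a \<in> A \<and> b \<in> A \<and>
     w \<in> carrier (free_group A) \<and> v \<in> carrier (free_group A) \<and> a = b \<and>
     (\<exists>n::int. w = fg_gen a [^]\<^bsub>free_group A\<^esub> n \<otimes>\<^bsub>free_group A\<^esub> v)}"

text \<open>An element of the free quandle is a class of pairs.\<close>

type_synonym 'a fq = "('a \<times> 'a fg_word) set"

definition fq_class :: "'a set \<Rightarrow> 'a \<Rightarrow> 'a fg_word \<Rightarrow> 'a fq" where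
  "fq_class A a w = fq_rel A `` {(a, w)}"

definition free_quandle :: "'a set \<Rightarrow> 'a fq set" where
  "free_quandle A = (A \<times> carrier (free_group A)) // fq_rel A"

text \<open>The union is over all representatives; the lemma \<open>fq_op_class\<close> below shows that
  the result does not depend on them.\<close>

definition fq_op :: "'a set \<Rightarrow> 'a fq \<Rightarrow> 'a fq \<Rightarrow> 'a fq" where
  "fq_op A P Q = (\<Union>(a, w)\<in>P. \<Union>(b, v)\<in>Q.
     fq_class A a (w \<otimes>\<^bsub>free_group A\<^esub> inv\<^bsub>free_group A\<^esub> v \<otimes>\<^bsub>free_group A\<^esub> fg_gen b \<otimes>\<^bsub>free_group A\<^esub> v))"

text \<open>The generating set of the inner automorphism group that is identified with \<open>A\<close>.\<close>

definition fq_gens :: "'a set \<Rightarrow> ('a fq \<Rightarrow> 'a fq) set" where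
  "fq_gens A = (\<lambda>a. point_symmetry (free_quandle A) (fq_op A) (fq_class A a \<one>\<^bsub>free_group A\<^esub>)) ` A"


section \<open>Consistency of the definitions\<close>

lemma inv_letter_inv_letter [simp]: "inv_letter (inv_letter x) = x"
  by (simp add: inv_letter_def)

lemma fst_inv_letter [simp]: "fst (inv_letter x) = fst x"
  by (simp add: inv_letter_def)

lemma inv_letter_neq [simp]: "inv_letter x \<noteq> x" "x \<noteq> inv_letter x"
  by (cases x; simp add: inv_letter_def)+

lemma fg_reduced_tl: "fg_reduced (x # xs) \<Longrightarrow> fg_reduced xs"
  by (cases xs) auto

lemma fg_reduced_push: "fg_reduced w \<Longrightarrow> fg_reduced (fg_push x w)"
  by (cases w) (auto dest: fg_reduced_tl)

lemma fg_push_inv: "fg_reduced w \<Longrightarrow> fg_push (inv_letter x) (fg_push x w) = w"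
  by (cases w rule: fg_reduced.cases) auto

lemma fg_push_reduced_Cons: "fg_reduced (x # w) \<Longrightarrow> fg_push x w = x # w"
  by (cases w) auto

lemma fg_reduced_foldr: "fg_reduced w \<Longrightarrow> fg_reduced (foldr fg_push u w)"
  by (induction u) (auto simp: fg_reduced_push)

lemma set_fg_push: "set (fg_push x w) \<subseteq> insert x (set w)"
  by (cases w) auto

lemma set_foldr_fg_push: "set (foldr fg_push u w) \<subseteq> set u \<union> set w"
  by (induction u) (use set_fg_push in fastforce)+

lemma foldr_fg_push_push:
  assumes "fg_reduced w"
  shows "foldr fg_push (fg_push x u) w = fg_push x (foldr fg_push u w)"
proof (cases u)
  case (Cons y ys)
  then show ?thesis
    using fg_push_inv[OF fg_reduced_foldr[OF assms], of "inv_letter x" ys] by auto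
qed auto

lemma foldr_fg_push_assoc:
  "fg_reduced w \<Longrightarrow> foldr fg_push (foldr fg_push u v) w = foldr fg_push u (foldr fg_push v w)"
  by (induction u) (auto simp: foldr_fg_push_push)

lemma foldr_fg_push_Nil: "fg_reduced w \<Longrightarrow> foldr fg_push w [] = w"
proof (induction w)
  case (Cons x w)
  then show ?case
    using fg_push_reduced_Cons[of x w] fg_reduced_tl[of x w] by simp
qed simp

lemma foldr_fg_push_inverse:
  "fg_reduced w \<Longrightarrow> foldr fg_push (rev (map inv_letter u)) (foldr fg_push u w) = w"
  by (induction u) (auto simp: fg_push_inv fg_reduced_foldr)

theorem group_free_group: "group (free_group A)"
proof (rule groupI)
  fix u v assume "u \<in> carrier (free_group A)" "v \<in> carrier (free_group A)"
  then show "u \<otimes>\<^bsub>free_group A\<^esub> v \<in> carrier (free_group A)"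
    using set_foldr_fg_push[of u v] by (fastforce simp: free_group_def fg_reduced_foldr)
next
  fix u assume u: "u \<in> carrier (free_group A)"
  let ?r = "foldr fg_push (rev (map inv_letter u)) []"
  have "?r \<in> carrier (free_group A)"
    using u set_foldr_fg_push[of "rev (map inv_letter u)" "[]"]
    by (fastforce simp: free_group_def fg_reduced_foldr)
  moreover have "?r \<otimes>\<^bsub>free_group A\<^esub> u = \<one>\<^bsub>free_group A\<^esub>"
    using u foldr_fg_push_inverse[of "[]" u]
    by (simp add: free_group_def foldr_fg_push_assoc foldr_fg_push_Nil)
  ultimately show "\<exists>v\<in>carrier (free_group A). v \<otimes>\<^bsub>free_group A\<^esub> u = \<one>\<^bsub>free_group A\<^esub>"
    by blast
qed (auto simp: free_group_def foldr_fg_push_assoc)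

lemma fg_gen_closed: "a \<in> A \<Longrightarrow> fg_gen a \<in> carrier (free_group A)"
  by (simp add: fg_gen_def free_group_def)

context quandle
begin

abbreviation "Aut \<equiv> quandle_Aut X (\<triangleleft>)"
abbreviation "Inn \<equiv> quandle_Inn X (\<triangleleft>)"

lemma closed: "x \<in> X \<Longrightarrow> y \<in> X \<Longrightarrow> x \<triangleleft> y \<in> X"
  using bij[of y] by (auto simp: bij_betw_def)

lemma Aut_closed: "f \<in> carrier Aut \<Longrightarrow> x \<in> X \<Longrightarrow> f x \<in> X"
  using Bij_imp_funcset by (fastforce simp: quandle_Aut_def)

lemma group_Aut: "group Aut"
proof (rule groupI)
  fix f assume f: "f \<in> carrier Aut"
  let ?g = "\<lambda>x\<in>X. inv_into X f x"
  from f have B: "f \<in> Bij X" and h: "\<And>x y. x \<in> X \<Longrightarrow> y \<in> X \<Longrightarrow> f (x \<triangleleft> y) = f x \<triangleleft> f y"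
    by (auto simp: quandle_Aut_def)
  have "inv_into X f (x \<triangleleft> y) = inv_into X f x \<triangleleft> inv_into X f y" if "x \<in> X" "y \<in> X" for x y
    by (rule Bij_inv_into_lemma) (use h B that closed in auto)
  then have "?g \<in> carrier Aut"
    using B by (auto simp: quandle_Aut_def restrict_inv_into_Bij closed simp del: restrict_apply)
       (auto simp: closed)
  moreover have "?g \<otimes>\<^bsub>Aut\<^esub> f = \<one>\<^bsub>Aut\<^esub>"
  proof
    fix x show "(?g \<otimes>\<^bsub>Aut\<^esub> f) x = \<one>\<^bsub>Aut\<^esub> x"
      using B by (auto simp: quandle_Aut_def compose_def Bij_def f_inv_into_f bij_betw_def inv_into_into)
  qed
  ultimately show "\<exists>g\<in>carrier Aut. g \<otimes>\<^bsub>Aut\<^esub> f = \<one>\<^bsub>Aut\<^esub>"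
    by blast
next
  fix f g assume "f \<in> carrier Aut" "g \<in> carrier Aut"
  then show "f \<otimes>\<^bsub>Aut\<^esub> g \<in> carrier Aut"
    using Aut_closed[of f] by (auto simp: quandle_Aut_def compose_Bij closed compose_eq)
next
  fix f g h assume "f \<in> carrier Aut" "g \<in> carrier Aut" "h \<in> carrier Aut"
  then show "f \<otimes>\<^bsub>Aut\<^esub> g \<otimes>\<^bsub>Aut\<^esub> h = f \<otimes>\<^bsub>Aut\<^esub> (g \<otimes>\<^bsub>Aut\<^esub> h)"
    using Aut_closed[of f] by (auto simp: quandle_Aut_def compose_def)
next
  fix f assume "f \<in> carrier Aut"
  then show "\<one>\<^bsub>Aut\<^esub> \<otimes>\<^bsub>Aut\<^esub> f = f"
    by (auto simp: quandle_Aut_def compose_def Bij_def extensional_def)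
qed (auto simp: quandle_Aut_def id_Bij closed)

lemma inv_Aut: "f \<in> carrier Aut \<Longrightarrow> x \<in> X \<Longrightarrow> (inv\<^bsub>Aut\<^esub> f) (f x) = x"
proof -
  assume f: "f \<in> carrier Aut" and x: "x \<in> X"
  have "(f \<otimes>\<^bsub>Aut\<^esub> g) x = g (f x)" for g
    using x by (simp add: quandle_Aut_def compose_eq)
  moreover have "\<one>\<^bsub>Aut\<^esub> x = x"
    using x by (simp add: quandle_Aut_def)
  ultimately show ?thesis
    using group.r_inv[OF group_Aut f] by metis
qed

lemma point_symmetry_Aut:
  assumes y: "y \<in> X"
  shows "point_symmetry X (\<triangleleft>) y \<in> carrier Aut"
proof -
  let ?s = "point_symmetry X (\<triangleleft>) y"
  have "?s \<in> Bij X"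
    using bij[OF y] by (simp add: point_symmetry_def Bij_def bij_betw_restrict_eq)
  moreover have "?s (u \<triangleleft> v) = ?s u \<triangleleft> ?s v" if "u \<in> X" "v \<in> X" for u v
    unfolding point_symmetry_def restrict_apply'[OF that(1)] restrict_apply'[OF that(2)]
      restrict_apply'[OF closed[OF that]]
    by (rule distrib[OF that y])
  ultimately show ?thesis
    by (simp add: quandle_Aut_def)
qed

lemma carrier_Inn: "carrier Inn = generate Aut (point_symmetry X (\<triangleleft>) ` X)"
proof -
  have "carrier Aut \<inter> point_symmetry X (\<triangleleft>) ` X = point_symmetry X (\<triangleleft>) ` X"
    using point_symmetry_Aut by blast
  then show ?thesis
    by (simp add: quandle_Inn_def carrier_subgroup_generated)
qed

lemma inv_Inn: "f \<in> carrier Inn \<Longrightarrow> inv\<^bsub>Inn\<^esub> f = inv\<^bsub>Aut\<^esub> f"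
  unfolding quandle_Inn_def by (rule group.inv_subgroup_generated[OF group_Aut])

end

lemma fq_relI:
  fixes n :: int
  assumes "a \<in> A" "w \<in> carrier (free_group A)" "v \<in> carrier (free_group A)"
    "w = fg_gen a [^]\<^bsub>free_group A\<^esub> n \<otimes>\<^bsub>free_group A\<^esub> v"
  shows "((a, w), (a, v)) \<in> fq_rel A"
  using assms unfolding fq_rel_def by blast

lemma equiv_fq_rel: "equiv (A \<times> carrier (free_group A)) (fq_rel A)"
proof -
  interpret F: group "free_group A" by (rule group_free_group)
  show ?thesis
  proof (rule equivI)
    show "refl_on (A \<times> carrier (free_group A)) (fq_rel A)"
      by (force simp: refl_on_def fq_rel_def intro: exI[of _ "0::int"])
    show "fq_rel A \<subseteq> (A \<times> carrier (free_group A)) \<times> (A \<times> carrier (free_group A))"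
      by (auto simp: fq_rel_def)
    show "sym (fq_rel A)"
    proof (rule symI)
      fix p q assume "(p, q) \<in> fq_rel A"
      then obtain a w v and n :: int where
        *: "p = (a, w)" "q = (a, v)" "a \<in> A" "w \<in> carrier (free_group A)" "v \<in> carrier (free_group A)"
          "w = fg_gen a [^]\<^bsub>free_group A\<^esub> n \<otimes>\<^bsub>free_group A\<^esub> v"
        by (auto simp: fq_rel_def)
      then have "v = fg_gen a [^]\<^bsub>free_group A\<^esub> (- n) \<otimes>\<^bsub>free_group A\<^esub> w"
        using F.inv_solve_left[of v "fg_gen a [^]\<^bsub>free_group A\<^esub> n" w]
        by (metis F.int_pow_closed F.int_pow_neg fg_gen_closed)
      with *(3-5) show "(q, p) \<in> fq_rel A"
        unfolding *(1,2) by (intro fq_relI)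
    qed
    show "trans (fq_rel A)"
    proof (rule transI)
      fix p q r assume "(p, q) \<in> fq_rel A" "(q, r) \<in> fq_rel A"
      then obtain a w v u and n m :: int where
        *: "p = (a, w)" "q = (a, v)" "r = (a, u)" "a \<in> A" "w \<in> carrier (free_group A)"
          "v \<in> carrier (free_group A)" "u \<in> carrier (free_group A)"
          "w = fg_gen a [^]\<^bsub>free_group A\<^esub> n \<otimes>\<^bsub>free_group A\<^esub> v"
          "v = fg_gen a [^]\<^bsub>free_group A\<^esub> m \<otimes>\<^bsub>free_group A\<^esub> u"
        by (auto simp: fq_rel_def)
      then have "w = fg_gen a [^]\<^bsub>free_group A\<^esub> (n + m) \<otimes>\<^bsub>free_group A\<^esub> u"
        by (metis F.int_pow_mult F.int_pow_closed F.m_assoc fg_gen_closed)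
      with *(4,5,7) show "(p, r) \<in> fq_rel A"
        unfolding *(1,3) by (intro fq_relI)
    qed
  qed
qed

lemma fq_class_in: "a \<in> A \<Longrightarrow> w \<in> carrier (free_group A) \<Longrightarrow> fq_class A a w \<in> free_quandle A"
  by (auto simp: fq_class_def free_quandle_def intro: quotientI)

lemma fq_cases:
  assumes "P \<in> free_quandle A"
  obtains a w where "a \<in> A" "w \<in> carrier (free_group A)" "P = fq_class A a w"
  using assms by (auto simp: fq_class_def free_quandle_def quotient_def)

lemma fq_class_self:
  "a \<in> A \<Longrightarrow> w \<in> carrier (free_group A) \<Longrightarrow> (a, w) \<in> fq_class A a w"
  unfolding fq_class_def by (rule equiv_class_self[OF equiv_fq_rel]) auto

lemma fq_class_eq_iff:
  assumes "a \<in> A" "w \<in> carrier (free_group A)" "b \<in> A" "v \<in> carrier (free_group A)"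
  shows "fq_class A a w = fq_class A b v \<longleftrightarrow>
    a = b \<and> (\<exists>n::int. w = fg_gen a [^]\<^bsub>free_group A\<^esub> n \<otimes>\<^bsub>free_group A\<^esub> v)"
  unfolding fq_class_def using assms
  by (subst eq_equiv_class_iff[OF equiv_fq_rel]) (auto simp: fq_rel_def)

lemma fq_op_class:
  assumes "a \<in> A" "w \<in> carrier (free_group A)" "b \<in> A" "v \<in> carrier (free_group A)"
  shows "fq_op A (fq_class A a w) (fq_class A b v) = fq_class A a
    (w \<otimes>\<^bsub>free_group A\<^esub> inv\<^bsub>free_group A\<^esub> v \<otimes>\<^bsub>free_group A\<^esub> fg_gen b \<otimes>\<^bsub>free_group A\<^esub> v)"
proof -
  interpret F: group "free_group A" by (rule group_free_group)
  let ?c = "\<lambda>a w b v. fq_class A a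
    (w \<otimes>\<^bsub>free_group A\<^esub> inv\<^bsub>free_group A\<^esub> v \<otimes>\<^bsub>free_group A\<^esub> fg_gen b \<otimes>\<^bsub>free_group A\<^esub> v)"
  have "?c a' w' b' v' = ?c a w b v"
    if "(a', w') \<in> fq_class A a w" "(b', v') \<in> fq_class A b v" for a' w' b' v'
  proof -
    from that obtain n m :: int where *: "a' = a" "b' = b"
      "w' \<in> carrier (free_group A)" "v' \<in> carrier (free_group A)"
      "w = fg_gen a [^]\<^bsub>free_group A\<^esub> n \<otimes>\<^bsub>free_group A\<^esub> w'"
      "v = fg_gen b [^]\<^bsub>free_group A\<^esub> m \<otimes>\<^bsub>free_group A\<^esub> v'"
      by (auto simp: fq_class_def fq_rel_def)
    let ?g = "fg_gen b" and ?h = "fg_gen b [^]\<^bsub>free_group A\<^esub> m"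
    have g: "?g \<in> carrier (free_group A)" "?h \<in> carrier (free_group A)"
      "fg_gen a [^]\<^bsub>free_group A\<^esub> n \<in> carrier (free_group A)"
      using assms by (auto simp: fg_gen_closed)
    have comm: "?g \<otimes>\<^bsub>free_group A\<^esub> ?h = ?h \<otimes>\<^bsub>free_group A\<^esub> ?g"
      using F.int_pow_mult[of ?g 1 m] F.int_pow_mult[of ?g m 1] g by (simp add: add.commute)
    have "inv\<^bsub>free_group A\<^esub> v \<otimes>\<^bsub>free_group A\<^esub> ?g \<otimes>\<^bsub>free_group A\<^esub> v =
      inv\<^bsub>free_group A\<^esub> v' \<otimes>\<^bsub>free_group A\<^esub> (inv\<^bsub>free_group A\<^esub> ?h \<otimes>\<^bsub>free_group A\<^esub>
        (?g \<otimes>\<^bsub>free_group A\<^esub> ?h)) \<otimes>\<^bsub>free_group A\<^esub> v'"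
      unfolding *(6) using g *(3,4) by (simp add: F.inv_mult_group F.m_assoc)
    also have "inv\<^bsub>free_group A\<^esub> ?h \<otimes>\<^bsub>free_group A\<^esub> (?g \<otimes>\<^bsub>free_group A\<^esub> ?h) = ?g"
      unfolding comm using g by (simp add: F.m_assoc[symmetric])
    finally have "w \<otimes>\<^bsub>free_group A\<^esub> (inv\<^bsub>free_group A\<^esub> v \<otimes>\<^bsub>free_group A\<^esub> ?g \<otimes>\<^bsub>free_group A\<^esub> v) =
      fg_gen a [^]\<^bsub>free_group A\<^esub> n \<otimes>\<^bsub>free_group A\<^esub>
        (w' \<otimes>\<^bsub>free_group A\<^esub> (inv\<^bsub>free_group A\<^esub> v' \<otimes>\<^bsub>free_group A\<^esub> ?g \<otimes>\<^bsub>free_group A\<^esub> v'))"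
      unfolding *(5) using g *(3,4) by (simp add: F.m_assoc)
    then have "?c a w b v = ?c a w' b v'"
      using assms g *(3,4) by (subst fq_class_eq_iff) (auto simp: F.m_assoc)
    with * show ?thesis by simp
  qed
  then have "fq_op A (fq_class A a w) (fq_class A b v) =
      (\<Union>p\<in>fq_class A a w. \<Union>q\<in>fq_class A b v. ?c a w b v)"
    unfolding fq_op_def by (fastforce intro!: SUP_cong)
  then show ?thesis
    using fq_class_self[OF assms(1,2)] fq_class_self[OF assms(3,4)] by auto
qed

theorem quandle_free_quandle:
  assumes "A \<noteq> {}"
  shows "quandle (free_quandle A) (fq_op A)"
proof -
  interpret F: group "free_group A" by (rule group_free_group)
  note g = fg_gen_closed
  show ?thesis
  proof
    show "free_quandle A \<noteq> {}"
      using assms fq_class_in[OF _ F.one_closed] by blast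
  next
    fix P assume "P \<in> free_quandle A"
    then obtain a w where P: "a \<in> A" "w \<in> carrier (free_group A)" "P = fq_class A a w"
      by (rule fq_cases)
    from P(1,2) have "fq_class A a (fg_gen a \<otimes>\<^bsub>free_group A\<^esub> w) = fq_class A a w"
      by (subst fq_class_eq_iff) (auto simp: g intro!: exI[of _ "1::int"])
    with P show "fq_op A P P = P"
      by (simp add: fq_op_class g F.m_assoc[symmetric])
  next
    fix Q assume "Q \<in> free_quandle A"
    then obtain b v where Q: "b \<in> A" "v \<in> carrier (free_group A)" "Q = fq_class A b v"
      by (rule fq_cases)
    define s where "s = inv\<^bsub>free_group A\<^esub> v \<otimes>\<^bsub>free_group A\<^esub> fg_gen b \<otimes>\<^bsub>free_group A\<^esub> v"
    have s: "s \<in> carrier (free_group A)" using Q by (simp add: g s_def)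
    have op: "fq_op A (fq_class A a w) Q = fq_class A a (w \<otimes>\<^bsub>free_group A\<^esub> s)"
      if "a \<in> A" "w \<in> carrier (free_group A)" for a w
      using that Q by (simp add: g fq_op_class s_def F.m_assoc)
    show "bij_betw (\<lambda>P. fq_op A P Q) (free_quandle A) (free_quandle A)"
    proof (rule bij_betw_imageI)
      show "inj_on (\<lambda>P. fq_op A P Q) (free_quandle A)"
      proof (rule inj_onI)
        fix P P' assume "P \<in> free_quandle A" "P' \<in> free_quandle A" and eq: "fq_op A P Q = fq_op A P' Q"
        then obtain a w a' w' where P: "a \<in> A" "w \<in> carrier (free_group A)" "P = fq_class A a w"
          "a' \<in> A" "w' \<in> carrier (free_group A)" "P' = fq_class A a' w'"
          by (metis fq_cases)
        with eq s obtain n :: int where "a = a'"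
          "w \<otimes>\<^bsub>free_group A\<^esub> s = fg_gen a [^]\<^bsub>free_group A\<^esub> n \<otimes>\<^bsub>free_group A\<^esub> (w' \<otimes>\<^bsub>free_group A\<^esub> s)"
          by (auto simp: op fq_class_eq_iff)
        then have "w = fg_gen a [^]\<^bsub>free_group A\<^esub> n \<otimes>\<^bsub>free_group A\<^esub> w'"
          using P s by (simp add: g F.m_assoc[symmetric])
        with P \<open>a = a'\<close> show "P = P'" by (auto simp: fq_class_eq_iff)
      qed
      have "fq_class A a w \<in> (\<lambda>P. fq_op A P Q) ` free_quandle A"
        if "a \<in> A" "w \<in> carrier (free_group A)" for a w
      proof
        show "fq_class A a w = fq_op A (fq_class A a (w \<otimes>\<^bsub>free_group A\<^esub> inv\<^bsub>free_group A\<^esub> s)) Q"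
          using that s by (simp add: op F.m_assoc)
        show "fq_class A a (w \<otimes>\<^bsub>free_group A\<^esub> inv\<^bsub>free_group A\<^esub> s) \<in> free_quandle A"
          using that s by (simp add: fq_class_in)
      qed
      then show "(\<lambda>P. fq_op A P Q) ` free_quandle A = free_quandle A"
        using s by (fastforce simp: op intro: fq_class_in elim!: fq_cases)
    qed
  next
    fix P Q R assume "P \<in> free_quandle A" "Q \<in> free_quandle A" "R \<in> free_quandle A"
    then obtain a w b v c u where
      *: "a \<in> A" "w \<in> carrier (free_group A)" "P = fq_class A a w"
        "b \<in> A" "v \<in> carrier (free_group A)" "Q = fq_class A b v"
        "c \<in> A" "u \<in> carrier (free_group A)" "R = fq_class A c u"
      by (metis fq_cases)
    define s where "s = inv\<^bsub>free_group A\<^esub> u \<otimes>\<^bsub>free_group A\<^esub> fg_gen c \<otimes>\<^bsub>free_group A\<^esub> u"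
    have s: "s \<in> carrier (free_group A)" using * by (simp add: g s_def)
    have op: "fq_op A (fq_class A d x) R = fq_class A d (x \<otimes>\<^bsub>free_group A\<^esub> s)"
      if "d \<in> A" "x \<in> carrier (free_group A)" for d x
      using that * by (simp add: g fq_op_class s_def F.m_assoc)
    have "inv\<^bsub>free_group A\<^esub> v = s \<otimes>\<^bsub>free_group A\<^esub> inv\<^bsub>free_group A\<^esub> (v \<otimes>\<^bsub>free_group A\<^esub> s)"
      using * s by (simp add: F.inv_mult_group F.m_assoc[symmetric])
    then show "fq_op A (fq_op A P Q) R = fq_op A (fq_op A P R) (fq_op A Q R)"
      using *(1-8) s by (simp add: g fq_op_class op F.m_assoc)
  qed
qed

end

theory Submission
  imports Defs
begin

text \<open>
  The elements of a connected component of the free quandle are the classes \<open>a\<^sup>w\<close> for one fixed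
  generator \<open>a\<close>, that is, the cosets of the cyclic subgroup generated by \<open>a\<close>; the inner graph joins
  \<open>a\<^sup>w\<close> to the classes \<open>a\<^bsup>wx\<^esup>\<close> with \<open>x\<close> a letter, so a component is the Schreier graph of that subgroup.
  Deleting the leading letters \<open>a\<close> and \<open>a\<^sup>-\<^sup>1\<close> of \<open>w\<close> gives a normal form: each class contains exactly
  one reduced word that does not begin with \<open>a\<close> or \<open>a\<^sup>-\<^sup>1\<close> (lemmas \<open>fq_class_eq_imp_coset_word_eq\<close> and
  \<open>fq_class_coset_word\<close>).

  Multiplying a normal form by a letter on the right appends the letter or deletes the last one,
  and the result is again a normal form, with one exception: at the empty word the letters \<open>a\<close> and
  \<open>a\<^sup>-\<^sup>1\<close> give loops. Away from these loops every vertex other than \<open>a\<^sup>1\<close> has exactly one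
  neighbour whose normal form is not longer, and \<open>a\<^sup>1\<close> has none. Such a graph is a tree
  (lemma \<open>tree_if_unique_lower_neighbour\<close>). Loops do not change path lengths
  (lemma \<open>path_metric_delete_loops\<close>), so the component is even isometric to a tree,
  namely to its own graph without the loops.
\<close>

section \<open>Trees and loops in graphs\<close>

text \<open>A cycle would contain a vertex of maximal height; its two neighbours on the cycle are
  not higher, so they coincide, which is impossible on a cycle of length at least three.\<close>

lemma tree_if_unique_lower_neighbour:
  fixes h :: "'v \<Rightarrow> nat"
  assumes root: "r \<in> V"
    and E: "E \<subseteq> V \<times> V" "sym E" "irrefl E"
    and lower: "\<And>x. x \<in> V \<Longrightarrow> x \<noteq> r \<Longrightarrow> \<exists>y. (x, y) \<in> E \<and> h y < h x"
    and unique: "\<And>x y z. (x, y) \<in> E \<Longrightarrow> (x, z) \<in> E \<Longrightarrow> h y \<le> h x \<Longrightarrow> h z \<le> h x \<Longrightarrow> y = z"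
  shows "tree V E"
proof -
  have to_root: "(x, r) \<in> E\<^sup>*" if "x \<in> V" for x
    using that
  proof (induction "h x" arbitrary: x rule: less_induct)
    case less
    show ?case
    proof (cases "x = r")
      case False
      then obtain y where y: "(x, y) \<in> E" "h y < h x"
        using lower less.prems by blast
      then have "(y, r) \<in> E\<^sup>*"
        using less.hyps E(1) by blast
      with y(1) show ?thesis
        by (rule converse_rtrancl_into_rtrancl)
    qed simp
  qed
  have "sym (E\<^sup>*)"
    using E(2) by (rule sym_rtrancl)
  then have connected: "(x, y) \<in> E\<^sup>*" if "x \<in> V" "y \<in> V" for x y
    using to_root[OF that(1)] to_root[OF that(2)] by (meson rtrancl_trans symD)
  have "\<not> graph_cycle E xs" for xs
  proof
    assume cycle: "graph_cycle E xs"
    define n where "n = length xs"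
    have n: "n \<ge> 3" and dist: "distinct xs"
      and edge: "\<And>i. i < n \<Longrightarrow> (xs ! i, xs ! (Suc i mod n)) \<in> E"
      using cycle by (auto simp: graph_cycle_def n_def)
    have "Max ((\<lambda>i. h (xs ! i)) ` {..<n}) \<in> (\<lambda>i. h (xs ! i)) ` {..<n}"
      using n by (intro Max_in) (auto simp: lessThan_empty_iff)
    then obtain k where k: "k < n" and "h (xs ! k) = Max ((\<lambda>i. h (xs ! i)) ` {..<n})"
      by auto
    then have max: "h (xs ! i) \<le> h (xs ! k)" if "i < n" for i
      using that by simp
    define i where "i = (if k = 0 then n - 1 else k - 1)"
    define j where "j = Suc k mod n"
    have i: "i < n" "Suc i mod n = k" and j: "j < n"
      using k n by (auto simp: i_def j_def)
    have "i \<noteq> j"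
      using k n by (auto simp: i_def j_def mod_Suc split: if_splits)
    moreover have "xs ! i = xs ! j"
    proof (rule unique)
      show "(xs ! k, xs ! i) \<in> E"
        using edge[OF i(1)] i(2) E(2) by (auto dest: symD)
      show "(xs ! k, xs ! j) \<in> E"
        using edge[OF k] by (simp add: j_def)
    qed (use max i j in auto)
    ultimately show False
      using dist i(1) j by (simp add: nth_eq_iff_index_eq n_def)
  qed
  then show ?thesis
    using root E connected by (auto simp: tree_def)
qed

lemma relpow_delete_loops:
  assumes "G `` Y \<subseteq> Y" "x \<in> Y" "(x, y) \<in> G ^^ n"
  shows "\<exists>m\<le>n. (x, y) \<in> (Restr G Y - Id) ^^ m"
  using assms(3)
proof (induction n arbitrary: y)
  case 0
  then show ?case by auto
next
  case (Suc n)
  then obtain z where z: "(x, z) \<in> G ^^ n" "(z, y) \<in> G"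
    by auto
  have "z \<in> Y"
    using z(1) assms(2) Image_closed_trancl[OF assms(1)] relpow_imp_rtrancl by fast
  then have zy: "z = y \<or> (z, y) \<in> Restr G Y - Id"
    using z(2) assms(1) by auto
  obtain m where m: "m \<le> n" "(x, z) \<in> (Restr G Y - Id) ^^ m"
    using Suc.IH[OF z(1)] by blast
  show ?case
    using zy
  proof
    assume "z = y"
    with m show ?thesis by (auto intro: le_SucI)
  next
    assume "(z, y) \<in> Restr G Y - Id"
    with m(2) have "(x, y) \<in> (Restr G Y - Id) ^^ Suc m"
      by (rule relpow_Suc_I)
    with m(1) show ?thesis by (meson Suc_le_mono)
  qed
qed

lemma path_metric_delete_loops:
  assumes "G `` Y \<subseteq> Y" "x \<in> Y"
  shows "path_metric (Restr G Y - Id) x y = path_metric G x y"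
proof -
  let ?E = "Restr G Y - Id"
  have fwd: "(x, y) \<in> G ^^ m" if "(x, y) \<in> ?E ^^ m" for m
    using that by (induction m arbitrary: y) auto
  have "(LEAST n. (x, y) \<in> ?E ^^ n) = (LEAST n. (x, y) \<in> G ^^ n)"
  proof (cases "\<exists>n. (x, y) \<in> G ^^ n")
    case True
    then have "(x, y) \<in> G ^^ (LEAST n. (x, y) \<in> G ^^ n)"
      by (rule LeastI_ex)
    then obtain m where m: "m \<le> (LEAST n. (x, y) \<in> G ^^ n)" "(x, y) \<in> ?E ^^ m"
      using relpow_delete_loops[OF assms] by blast
    show ?thesis
    proof (rule antisym)
      show "(LEAST n. (x, y) \<in> ?E ^^ n) \<le> (LEAST n. (x, y) \<in> G ^^ n)"
        using Least_le[of "\<lambda>n. (x, y) \<in> ?E ^^ n", OF m(2)] m(1) by linarith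
      show "(LEAST n. (x, y) \<in> G ^^ n) \<le> (LEAST n. (x, y) \<in> ?E ^^ n)"
        using m(2) by (intro Least_le fwd LeastI)
    qed
  next
    case False
    then have "(\<lambda>n. (x, y) \<in> ?E ^^ n) = (\<lambda>n. (x, y) \<in> G ^^ n)"
      using fwd by blast
    then show ?thesis by simp
  qed
  then show ?thesis by (simp add: path_metric_def)
qed

lemma path_metric_refl: "path_metric E x x = 0"
  by (simp add: path_metric_def Least_equality)


section \<open>Multiplication by a letter in the free group\<close>

lemma fg_reduced_appendD: "fg_reduced (u @ v) \<Longrightarrow> fg_reduced u"
  by (induction u rule: fg_reduced.induct) auto

lemma fg_reduced_snoc:
  "fg_reduced (u @ [m]) \<Longrightarrow> l \<noteq> inv_letter m \<Longrightarrow> fg_reduced (u @ [m, l])"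
  by (induction u rule: fg_reduced.induct) auto

lemma foldr_fg_push_append: "fg_reduced (u @ v) \<Longrightarrow> foldr fg_push u v = u @ v"
proof (induction u)
  case (Cons x u)
  then show ?case
    using fg_push_reduced_Cons[of x "u @ v"] fg_reduced_tl[of x "u @ v"] by simp
qed simp

lemma free_group_mult_letter:
  assumes "w \<in> carrier (free_group A)"
  shows "w \<otimes>\<^bsub>free_group A\<^esub> [l] =
    (if w \<noteq> [] \<and> l = inv_letter (last w) then butlast w else w @ [l])"
proof (cases w rule: rev_cases)
  case Nil
  then show ?thesis by (simp add: free_group_def)
next
  case (snoc u m)
  then have "fg_reduced (u @ [m])"
    using assms by (simp add: free_group_def)
  then show ?thesis
    using snoc fg_reduced_appendD[of u "[m]"] fg_reduced_snoc[of u m l]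
    by (auto simp: free_group_def foldr_fg_push_Nil foldr_fg_push_append)
qed

lemma letter_in_free_group: "fst l \<in> A \<Longrightarrow> [l] \<in> carrier (free_group A)"
  by (simp add: free_group_def)

lemma inv_free_group_letter:
  assumes "fst l \<in> A"
  shows "inv\<^bsub>free_group A\<^esub> [l] = [inv_letter l]"
proof -
  interpret F: group "free_group A" by (rule group_free_group)
  have "[inv_letter l] \<otimes>\<^bsub>free_group A\<^esub> [l] = \<one>\<^bsub>free_group A\<^esub>"
    by (simp add: free_group_def)
  then show ?thesis
    using assms by (intro F.inv_equality) (auto intro: letter_in_free_group)
qed

lemma prefix_in_free_group: "u @ v \<in> carrier (free_group A) \<Longrightarrow> u \<in> carrier (free_group A)"
  by (auto simp: free_group_def dest: fg_reduced_appendD)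


section \<open>Normal forms of the elements of the free quandle\<close>

text \<open>The normal form of \<open>w\<close> modulo left multiplication by powers of \<open>a\<close>.\<close>

definition coset_word :: "'a \<Rightarrow> 'a fg_word \<Rightarrow> 'a fg_word" where
  "coset_word a w = dropWhile (\<lambda>l. fst l = a) w"

lemma coset_word_push: "fst l = a \<Longrightarrow> coset_word a (fg_push l w) = coset_word a w"
  by (cases w) (auto simp: coset_word_def)

lemma coset_word_nat_pow:
  assumes "a \<in> A" "v \<in> carrier (free_group A)"
  shows "coset_word a (fg_gen a [^]\<^bsub>free_group A\<^esub> (n :: nat) \<otimes>\<^bsub>free_group A\<^esub> v) = coset_word a v"
proof -
  interpret F: group "free_group A" by (rule group_free_group)
  show ?thesis
  proof (induction n)
    case 0
    then show ?case using assms by simp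
  next
    case (Suc n)
    have "fg_gen a [^]\<^bsub>free_group A\<^esub> Suc n \<otimes>\<^bsub>free_group A\<^esub> v =
        fg_gen a \<otimes>\<^bsub>free_group A\<^esub> (fg_gen a [^]\<^bsub>free_group A\<^esub> n \<otimes>\<^bsub>free_group A\<^esub> v)"
      unfolding F.nat_pow_Suc2[OF fg_gen_closed[OF assms(1)]]
      using assms by (simp add: F.m_assoc fg_gen_closed)
    also have "\<dots> = fg_push (a, True) (fg_gen a [^]\<^bsub>free_group A\<^esub> n \<otimes>\<^bsub>free_group A\<^esub> v)"
      by (simp add: free_group_def fg_gen_def)
    finally show ?case
      using Suc.IH by (simp add: coset_word_push)
  qed
qed

lemma fq_class_eq_imp_coset_word_eq:
  assumes "a \<in> A" "w \<in> carrier (free_group A)" "v \<in> carrier (free_group A)"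
    and "fq_class A a w = fq_class A a v"
  shows "coset_word a w = coset_word a v"
proof -
  interpret F: group "free_group A" by (rule group_free_group)
  obtain n :: int where n: "w = fg_gen a [^]\<^bsub>free_group A\<^esub> n \<otimes>\<^bsub>free_group A\<^esub> v"
    using assms by (auto simp: fq_class_eq_iff)
  show ?thesis
  proof (cases n)
    case (nonneg k)
    with n assms show ?thesis
      by (simp add: int_pow_int coset_word_nat_pow)
  next
    \<comment> \<open>A negative power on one side is a positive power on the other.\<close>
    case (neg k)
    have "v = fg_gen a [^]\<^bsub>free_group A\<^esub> (- n) \<otimes>\<^bsub>free_group A\<^esub> w"
      unfolding n using assms
      by (simp add: F.int_pow_neg fg_gen_closed F.m_assoc[symmetric])
    also have "- n = int (Suc k)"
      using neg by simp
    finally show ?thesis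
      using assms coset_word_nat_pow[of a A w "Suc k"] by (simp only: int_pow_int)
  qed
qed

lemma fq_class_Cons_same:
  assumes "fst l \<in> A" "l # w \<in> carrier (free_group A)"
  shows "fq_class A (fst l) (l # w) = fq_class A (fst l) w"
proof -
  interpret F: group "free_group A" by (rule group_free_group)
  let ?a = "fst l"
  have w: "w \<in> carrier (free_group A)"
    using assms(2) by (auto simp: free_group_def dest: fg_reduced_tl)
  have "l # w = [l] \<otimes>\<^bsub>free_group A\<^esub> w"
    using assms(2) fg_push_reduced_Cons[of l w] by (simp add: free_group_def)
  also have "[l] = fg_gen ?a [^]\<^bsub>free_group A\<^esub> (if snd l then 1 else - 1 :: int)"
    using assms(1) inv_free_group_letter[of "(?a, True)" A] fg_gen_closed[OF assms(1)]
    by (cases l) (auto simp: F.int_pow_neg fg_gen_def inv_letter_def letter_in_free_group)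
  finally show ?thesis
    using assms w by (subst fq_class_eq_iff) blast+
qed

lemma coset_word_in_free_group:
  "w \<in> carrier (free_group A) \<Longrightarrow> coset_word a w \<in> carrier (free_group A)"
  unfolding coset_word_def
  by (induction w) (auto simp: free_group_def dest: fg_reduced_tl)

lemma fq_class_coset_word:
  "a \<in> A \<Longrightarrow> w \<in> carrier (free_group A) \<Longrightarrow> fq_class A a (coset_word a w) = fq_class A a w"
proof (induction w)
  case (Cons l w)
  have "w \<in> carrier (free_group A)"
    using Cons.prems(2) by (auto simp: free_group_def dest: fg_reduced_tl)
  then show ?case
    using Cons fq_class_Cons_same[of l A w] by (cases "fst l = a") (auto simp: coset_word_def)
qed (simp add: coset_word_def)

lemma coset_word_idem: "coset_word a (coset_word a w) = coset_word a w"
  by (simp add: coset_word_def dropWhile_idem)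

lemma coset_word_id_iff: "coset_word a w = w \<longleftrightarrow> w = [] \<or> fst (hd w) \<noteq> a"
proof (cases w)
  case (Cons x xs)
  then show ?thesis
    using length_dropWhile_le[of "\<lambda>l. fst l = a" xs]
    by (auto simp: coset_word_def dest: arg_cong[where f = length])
qed (simp add: coset_word_def)


section \<open>The inner graph and the components of the free quandle\<close>

lemma (in quandle) group_Inn: "group Inn"
  unfolding quandle_Inn_def by (rule group.group_subgroup_generated[OF group_Aut])

lemma (in quandle) point_symmetry_Inn: "y \<in> X \<Longrightarrow> point_symmetry X (\<triangleleft>) y \<in> carrier Inn"
  unfolding carrier_Inn by (intro generate.incl imageI)

lemma (in quandle) component_closed_inner_graph:
  assumes "Y \<in> quandle_components X (\<triangleleft>)" "S \<subseteq> carrier Inn"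
  shows "inner_graph X (\<triangleleft>) S `` Y \<subseteq> Y"
proof
  interpret I: group Inn by (rule group_Inn)
  fix y assume "y \<in> inner_graph X (\<triangleleft>) S `` Y"
  then obtain x s where x: "x \<in> Y" and s: "s \<in> S \<union> m_inv Inn ` S" "y = s x"
    by (auto simp: inner_graph_def)
  obtain z where z: "z \<in> X" "Y = orbit Inn (\<lambda>f. f) z"
    using assms(1) by (auto simp: quandle_components_def orbits_def)
  then obtain f where f: "f \<in> carrier Inn" "x = f z"
    using x by (auto simp: orbit_def)
  have "s \<in> carrier Inn"
    using s(1) assms(2) by auto
  then have "f \<otimes>\<^bsub>Inn\<^esub> s \<in> carrier Inn"
    using f(1) by simp
  moreover have "y = (f \<otimes>\<^bsub>Inn\<^esub> s) z"
    using f s(2) z(1) by (simp add: quandle_Inn_def quandle_Aut_def compose_eq)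
  ultimately show "y \<in> Y"
    using z(2) by (auto simp: orbit_def)
qed

lemma point_symmetry_fq_class:
  assumes "a \<in> A" "w \<in> carrier (free_group A)" "b \<in> A"
  shows "point_symmetry (free_quandle A) (fq_op A) (fq_class A b \<one>\<^bsub>free_group A\<^esub>) (fq_class A a w) =
    fq_class A a (w \<otimes>\<^bsub>free_group A\<^esub> fg_gen b)"
proof -
  interpret F: group "free_group A" by (rule group_free_group)
  show ?thesis
    using assms by (simp add: point_symmetry_def fq_class_in fq_op_class fg_gen_closed)
qed

lemma fq_gens_Inn:
  assumes "A \<noteq> {}"
  shows "fq_gens A \<subseteq> carrier (quandle_Inn (free_quandle A) (fq_op A))"
proof -
  interpret F: group "free_group A" by (rule group_free_group)
  interpret quandle "free_quandle A" "fq_op A" by (rule quandle_free_quandle[OF assms])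
  show ?thesis
    by (auto simp: fq_gens_def intro!: point_symmetry_Inn fq_class_in)
qed

lemma inv_point_symmetry_fq_class:
  assumes "a \<in> A" "w \<in> carrier (free_group A)" "b \<in> A"
  shows "(inv\<^bsub>quandle_Inn (free_quandle A) (fq_op A)\<^esub>
      point_symmetry (free_quandle A) (fq_op A) (fq_class A b \<one>\<^bsub>free_group A\<^esub>)) (fq_class A a w) =
    fq_class A a (w \<otimes>\<^bsub>free_group A\<^esub> inv\<^bsub>free_group A\<^esub> fg_gen b)"
proof -
  interpret F: group "free_group A" by (rule group_free_group)
  interpret quandle "free_quandle A" "fq_op A"
    using assms(1) by (intro quandle_free_quandle) auto
  let ?s = "point_symmetry (free_quandle A) (fq_op A) (fq_class A b \<one>\<^bsub>free_group A\<^esub>)"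
  let ?v = "w \<otimes>\<^bsub>free_group A\<^esub> inv\<^bsub>free_group A\<^esub> fg_gen b"
  have v: "?v \<in> carrier (free_group A)" and b: "fq_class A b \<one>\<^bsub>free_group A\<^esub> \<in> free_quandle A"
    using assms by (auto simp: fg_gen_closed fq_class_in)
  have "?s (fq_class A a ?v) = fq_class A a w"
    using assms v by (simp add: point_symmetry_fq_class fg_gen_closed F.m_assoc)
  then show ?thesis
    using inv_Aut[OF point_symmetry_Aut[OF b] fq_class_in[OF assms(1) v]]
    by (simp add: inv_Inn point_symmetry_Inn b)
qed

lemma inner_graph_free_quandle:
  "inner_graph (free_quandle A) (fq_op A) (fq_gens A) =
    {(fq_class A a w, fq_class A a (w \<otimes>\<^bsub>free_group A\<^esub> [l])) | a w l.
      a \<in> A \<and> w \<in> carrier (free_group A) \<and> fst l \<in> A}" (is "?G = ?R")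
proof (intro equalityI subrelI)
  fix P Q assume "(P, Q) \<in> ?G"
  then obtain s where P: "P \<in> free_quandle A" and Q: "Q = s P"
    and s: "s \<in> fq_gens A \<union> m_inv (quandle_Inn (free_quandle A) (fq_op A)) ` fq_gens A"
    by (auto simp: inner_graph_def)
  from P obtain a w where aw: "a \<in> A" "w \<in> carrier (free_group A)" "P = fq_class A a w"
    by (rule fq_cases)
  from s obtain b where b: "b \<in> A" and "Q = fq_class A a (w \<otimes>\<^bsub>free_group A\<^esub> fg_gen b) \<or>
      Q = fq_class A a (w \<otimes>\<^bsub>free_group A\<^esub> inv\<^bsub>free_group A\<^esub> fg_gen b)"
    using Q aw by (auto simp: fq_gens_def point_symmetry_fq_class inv_point_symmetry_fq_class)
  then have "\<exists>c. Q = fq_class A a (w \<otimes>\<^bsub>free_group A\<^esub> [(b, c)])"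
    by (auto simp: fg_gen_def inv_free_group_letter inv_letter_def)
  then obtain c where "Q = fq_class A a (w \<otimes>\<^bsub>free_group A\<^esub> [(b, c)])"
    by blast
  then show "(P, Q) \<in> ?R"
    using aw b by fastforce
next
  fix P Q assume "(P, Q) \<in> ?R"
  then obtain a w b c where aw: "a \<in> A" "w \<in> carrier (free_group A)" "P = fq_class A a w"
    and b: "b \<in> A" and Q: "Q = fq_class A a (w \<otimes>\<^bsub>free_group A\<^esub> [(b, c)])"
    by force
  let ?s = "point_symmetry (free_quandle A) (fq_op A) (fq_class A b \<one>\<^bsub>free_group A\<^esub>)"
  let ?t = "if c then ?s else inv\<^bsub>quandle_Inn (free_quandle A) (fq_op A)\<^esub> ?s"
  have "?s \<in> fq_gens A"
    using b by (auto simp: fq_gens_def)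
  then have "?t \<in> fq_gens A \<union> m_inv (quandle_Inn (free_quandle A) (fq_op A)) ` fq_gens A"
    by auto
  moreover have "inv\<^bsub>free_group A\<^esub> fg_gen b = [(b, False)]"
    using b by (simp add: fg_gen_def inv_free_group_letter inv_letter_def)
  then have "Q = ?t P"
    using aw b Q by (simp add: point_symmetry_fq_class inv_point_symmetry_fq_class)
      (simp add: fg_gen_def)
  ultimately show "(P, Q) \<in> ?G"
    using aw by (auto simp: inner_graph_def fq_class_in)
qed

lemma inner_graph_free_quandle_letterI:
  assumes "a \<in> A" "w \<in> carrier (free_group A)" "fst l \<in> A"
  shows "(fq_class A a w, fq_class A a (w \<otimes>\<^bsub>free_group A\<^esub> [l])) \<in>
    inner_graph (free_quandle A) (fq_op A) (fq_gens A)"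
  unfolding inner_graph_free_quandle using assms by blast

text \<open>The neighbours of a class can be computed from any of its representatives, because left
  multiplication by powers of \<open>a\<close> commutes with right multiplication by letters.\<close>

lemma inner_graph_free_quandle_letterE:
  assumes "a \<in> A" "u \<in> carrier (free_group A)"
    and "(fq_class A a u, Q) \<in> inner_graph (free_quandle A) (fq_op A) (fq_gens A)"
  obtains l where "fst l \<in> A" "Q = fq_class A a (u \<otimes>\<^bsub>free_group A\<^esub> [l])"
proof -
  interpret F: group "free_group A" by (rule group_free_group)
  from assms(3) obtain b w l where bwl: "fq_class A b w = fq_class A a u"
    "Q = fq_class A b (w \<otimes>\<^bsub>free_group A\<^esub> [l])"
    "b \<in> A" "w \<in> carrier (free_group A)" "fst l \<in> A"
    unfolding inner_graph_free_quandle mem_Collect_eq prod.inject by metis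
  obtain n :: int where ba: "b = a" and w: "w = fg_gen a [^]\<^bsub>free_group A\<^esub> n \<otimes>\<^bsub>free_group A\<^esub> u"
    using fq_class_eq_iff[OF bwl(3,4) assms(1,2)] bwl(1) by auto
  have l: "[l] \<in> carrier (free_group A)"
    using bwl(5) by (rule letter_in_free_group)
  have "w \<otimes>\<^bsub>free_group A\<^esub> [l] =
      fg_gen a [^]\<^bsub>free_group A\<^esub> n \<otimes>\<^bsub>free_group A\<^esub> (u \<otimes>\<^bsub>free_group A\<^esub> [l])"
    unfolding w using assms l by (simp add: F.m_assoc fg_gen_closed)
  then have "fq_class A a (w \<otimes>\<^bsub>free_group A\<^esub> [l]) = fq_class A a (u \<otimes>\<^bsub>free_group A\<^esub> [l])"
    using assms l bwl(4) by (subst fq_class_eq_iff) (auto simp: fg_gen_closed)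
  with bwl(2,5) ba that show ?thesis
    by blast
qed

text \<open>Every point symmetry, and hence its inverse, leaves the generator \<open>a\<close> of a class
  \<open>a\<^sup>w\<close> unchanged.\<close>

lemma Inn_fq_class:
  assumes "f \<in> carrier (quandle_Inn (free_quandle A) (fq_op A))"
    and "a \<in> A" "w \<in> carrier (free_group A)"
  shows "f (fq_class A a w) \<in> fq_class A a ` carrier (free_group A)"
proof -
  interpret F: group "free_group A" by (rule group_free_group)
  interpret quandle "free_quandle A" "fq_op A"
    using assms(2) by (intro quandle_free_quandle) auto
  have sym: "point_symmetry (free_quandle A) (fq_op A) Q (fq_class A a w)
      \<in> fq_class A a ` carrier (free_group A)"
    if "Q \<in> free_quandle A" "a \<in> A" "w \<in> carrier (free_group A)" for Q a w
    using that(1)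
  proof (rule fq_cases)
    fix b v assume "b \<in> A" "v \<in> carrier (free_group A)" "Q = fq_class A b v"
    then show ?thesis
      using that by (auto simp: point_symmetry_def fq_class_in fq_op_class fg_gen_closed)
  qed
  have "f \<in> generate Aut (point_symmetry (free_quandle A) (fq_op A) ` free_quandle A)"
    using assms(1) by (simp add: carrier_Inn)
  then show ?thesis
    using assms(3)
  proof (induction arbitrary: w)
    case one
    then show ?case
      using assms(2) by (simp add: quandle_Aut_def fq_class_in)
  next
    case (incl s)
    then show ?case
      using sym assms(2) by auto
  next
    case (inv s)
    then obtain Q where Q: "Q \<in> free_quandle A" "s = point_symmetry (free_quandle A) (fq_op A) Q"
      by auto
    have s: "s \<in> carrier Aut"
      unfolding Q(2) using Q(1) by (rule point_symmetry_Aut)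
    have "bij_betw s (free_quandle A) (free_quandle A)"
      using s by (simp add: quandle_Aut_def Bij_def)
    moreover have "fq_class A a w \<in> free_quandle A"
      using assms(2) inv.prems by (rule fq_class_in)
    ultimately obtain P where P: "P \<in> free_quandle A" "fq_class A a w = s P"
      by (auto simp: bij_betw_def)
    obtain b v where bv: "b \<in> A" "v \<in> carrier (free_group A)" "P = fq_class A b v"
      using P(1) by (rule fq_cases)
    obtain u where "u \<in> carrier (free_group A)" "fq_class A a w = fq_class A b u"
      using sym[OF Q(1) bv(1,2)] P(2) bv(3) Q(2) by auto
    then have "a = b"
      using fq_class_eq_iff[OF assms(2) inv.prems bv(1)] by blast
    then show ?case
      using inv_Aut[OF s P(1)] P(2) bv by simp
  next
    case (eng f g)
    obtain v where v: "v \<in> carrier (free_group A)" "f (fq_class A a w) = fq_class A a v"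
      using eng.IH(1)[OF eng.prems] by auto
    have "(f \<otimes>\<^bsub>Aut\<^esub> g) (fq_class A a w) = g (f (fq_class A a w))"
      using assms(2) eng.prems by (simp add: quandle_Aut_def compose_eq fq_class_in)
    then show ?case
      using eng.IH(2)[OF v(1)] v(2) by simp
  qed
qed

text \<open>Reading a word \<open>u\<close> letter by letter gives a path from \<open>a\<^sup>w\<close> to \<open>a\<^bsup>wu\<^esup>\<close>; with
  \<open>u = w\<^sup>-\<^sup>1v\<close> it ends at \<open>a\<^sup>v\<close>, so all classes over the same generator \<open>a\<close> are connected.\<close>

lemma component_free_quandle:
  assumes "A \<noteq> {}" "Y \<in> quandle_components (free_quandle A) (fq_op A)"
  obtains a where "a \<in> A" "Y = fq_class A a ` carrier (free_group A)"
proof -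
  interpret F: group "free_group A" by (rule group_free_group)
  interpret quandle "free_quandle A" "fq_op A" by (rule quandle_free_quandle[OF assms(1)])
  interpret I: group Inn by (rule group_Inn)
  obtain P where P: "P \<in> free_quandle A" "Y = orbit Inn (\<lambda>f. f) P"
    using assms(2) by (auto simp: quandle_components_def orbits_def)
  obtain a w where aw: "a \<in> A" "w \<in> carrier (free_group A)" "P = fq_class A a w"
    using P(1) by (rule fq_cases)
  have step: "Q \<in> Y" if "R \<in> Y" "(R, Q) \<in> inner_graph (free_quandle A) (fq_op A) (fq_gens A)" for R Q
    using component_closed_inner_graph[OF assms(2) fq_gens_Inn[OF assms(1)]] that by blast
  have "\<one>\<^bsub>Inn\<^esub> P = P"
    using P(1) by (simp add: quandle_Inn_def quandle_Aut_def)
  then have "P \<in> Y"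
    unfolding P(2) orbit_def using I.one_closed by (metis (mono_tags, lifting) mem_Collect_eq)
  have reach: "fq_class A a (w \<otimes>\<^bsub>free_group A\<^esub> u) \<in> Y" if "u \<in> carrier (free_group A)" for u
    using that
  proof (induction u rule: rev_induct)
    case Nil
    have "w \<otimes>\<^bsub>free_group A\<^esub> [] = w"
      using F.r_one[OF aw(2)] by (simp add: free_group_def)
    then show ?case
      using \<open>P \<in> Y\<close> aw(3) by simp
  next
    case (snoc l u)
    have u: "u \<in> carrier (free_group A)"
      using snoc.prems by (rule prefix_in_free_group)
    have l: "fst l \<in> A"
      using snoc.prems by (simp add: free_group_def)
    have "u @ [l] = u \<otimes>\<^bsub>free_group A\<^esub> [l]"
      using snoc.prems by (simp add: free_group_def foldr_fg_push_append)
    then have "w \<otimes>\<^bsub>free_group A\<^esub> (u @ [l]) = w \<otimes>\<^bsub>free_group A\<^esub> u \<otimes>\<^bsub>free_group A\<^esub> [l]"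
      using aw(2) u letter_in_free_group[OF l] by (simp add: F.m_assoc)
    moreover have "w \<otimes>\<^bsub>free_group A\<^esub> u \<in> carrier (free_group A)"
      using aw(2) u by simp
    ultimately show ?case
      using step[OF snoc.IH[OF u]] inner_graph_free_quandle_letterI[OF aw(1) _ l] by simp
  qed
  have "fq_class A a v \<in> Y" if "v \<in> carrier (free_group A)" for v
    using reach[of "inv\<^bsub>free_group A\<^esub> w \<otimes>\<^bsub>free_group A\<^esub> v"] that aw(2)
    by (simp add: F.m_assoc[symmetric])
  moreover have "Y \<subseteq> fq_class A a ` carrier (free_group A)"
    using Inn_fq_class[OF _ aw(1,2)] P(2) aw(3) by (auto simp: orbit_def)
  ultimately show ?thesis
    using aw(1) that by blast
qed


section \<open>Components without loops are trees\<close>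

lemma tree_component_free_quandle:
  assumes a: "a \<in> A" and Y: "Y = fq_class A a ` carrier (free_group A)"
  shows "tree Y (Restr (inner_graph (free_quandle A) (fq_op A) (fq_gens A)) Y - Id)"
proof -
  interpret F: group "free_group A" by (rule group_free_group)
  let ?G = "inner_graph (free_quandle A) (fq_op A) (fq_gens A)"
  let ?E = "Restr ?G Y - Id"
  let ?N = "{u \<in> carrier (free_group A). coset_word a u = u}"
  define nf where "nf P = inv_into ?N (fq_class A a) P" for P
  have inj: "inj_on (fq_class A a) ?N"
  proof (rule inj_onI)
    fix u v assume "u \<in> ?N" "v \<in> ?N" "fq_class A a u = fq_class A a v"
    then show "u = v"
      using fq_class_eq_imp_coset_word_eq[OF a, of u v] by simp
  qed
  have nf_class: "nf (fq_class A a u) = u" if "u \<in> ?N" for u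
    unfolding nf_def using inj that by (rule inv_into_f_f)
  have Y_cases: "\<exists>u\<in>?N. P = fq_class A a u" if P: "P \<in> Y" for P
  proof -
    obtain w where w: "w \<in> carrier (free_group A)" "P = fq_class A a w"
      using P Y by blast
    then have "coset_word a w \<in> ?N" "P = fq_class A a (coset_word a w)"
      using a by (auto simp: coset_word_in_free_group fq_class_coset_word coset_word_idem)
    then show ?thesis by blast
  qed
  have prefix: "butlast u \<in> ?N" if "u \<in> ?N" for u
    using that prefix_in_free_group[of "butlast u" "[last u]" A]
    by (cases u) (auto simp: coset_word_id_iff)
  \<comment> \<open>Without the loops, each edge at \<open>a\<^sup>u\<close> deletes the last letter of \<open>u\<close> or appends one.\<close>
  have edge_cases: "u \<noteq> [] \<and> Q = fq_class A a (butlast u) \<or> length (nf Q) = Suc (length u)"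
    if u: "u \<in> ?N" and PQ: "(fq_class A a u, Q) \<in> ?E" for u Q
  proof -
    have "(fq_class A a u, Q) \<in> ?G"
      using PQ by blast
    then obtain l where l: "fst l \<in> A" and Q: "Q = fq_class A a (u \<otimes>\<^bsub>free_group A\<^esub> [l])"
      using a u inner_graph_free_quandle_letterE[of a A u Q] by blast
    show ?thesis
    proof (cases "u \<noteq> [] \<and> l = inv_letter (last u)")
      case True
      then show ?thesis
        using Q u by (simp add: free_group_mult_letter)
    next
      case False
      then have ul: "u \<otimes>\<^bsub>free_group A\<^esub> [l] = u @ [l]"
        using u by (auto simp: free_group_mult_letter)
      have "\<not> (u = [] \<and> fst l = a)"
      proof
        \<comment> \<open>This is the loop at \<open>a\<^sup>1\<close>, which has been removed.\<close>
        assume *: "u = [] \<and> fst l = a"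
        then have "Q = fq_class A a u"
          using Q ul fq_class_Cons_same[of l A "[]"] letter_in_free_group[OF l] l by simp
        then show False
          using PQ by simp
      qed
      then have "coset_word a (u @ [l]) = u @ [l]"
        using u by (cases u) (auto simp: coset_word_id_iff)
      moreover have "u @ [l] \<in> carrier (free_group A)"
        using F.m_closed[of u "[l]"] letter_in_free_group[OF l] u ul by simp
      ultimately show ?thesis
        using nf_class Q ul by simp
    qed
  qed
  show ?thesis
  proof (rule tree_if_unique_lower_neighbour[where h = "\<lambda>P. length (nf P)" and r = "fq_class A a []"])
    show "fq_class A a [] \<in> Y"
      unfolding Y by (auto simp: free_group_def)
    show "?E \<subseteq> Y \<times> Y" "irrefl ?E"
      by (auto simp: irrefl_def)
    have "(Q, P) \<in> ?G" if PQ: "(P, Q) \<in> ?G" for P Q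
    proof -
      obtain b w where bw: "b \<in> A" "w \<in> carrier (free_group A)" "P = fq_class A b w"
        using PQ fq_cases[of P A] unfolding inner_graph_def by blast
      obtain l where fl: "fst l \<in> A" and Q: "Q = fq_class A b (w \<otimes>\<^bsub>free_group A\<^esub> [l])"
        using inner_graph_free_quandle_letterE[OF bw(1,2)] PQ bw(3) by blast
      have l: "[l] \<in> carrier (free_group A)"
        using fl by (rule letter_in_free_group)
      have "w \<otimes>\<^bsub>free_group A\<^esub> [l] \<otimes>\<^bsub>free_group A\<^esub> [inv_letter l] = w"
        using bw fl l F.r_inv[OF l] F.inv_closed[OF l]
        by (simp add: inv_free_group_letter F.m_assoc)
      moreover have "w \<otimes>\<^bsub>free_group A\<^esub> [l] \<in> carrier (free_group A)"
        using bw(2) l by simp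
      ultimately show ?thesis
        using bw fl Q inner_graph_free_quandle_letterI[of b A "w \<otimes>\<^bsub>free_group A\<^esub> [l]" "inv_letter l"]
        by simp
    qed
    then show "sym ?E"
      by (auto intro!: symI)
  next
    fix P assume P: "P \<in> Y" "P \<noteq> fq_class A a []"
    obtain u where u: "u \<in> ?N" "P = fq_class A a u"
      using Y_cases[OF P(1)] by blast
    let ?Q = "fq_class A a (butlast u)"
    have "u \<noteq> []"
      using P(2) u(2) by auto
    then have less: "length (nf ?Q) < length (nf P)"
      using u prefix[OF u(1)] by (simp add: nf_class)
    have "fst (last u) \<in> A"
      using u(1) \<open>u \<noteq> []\<close> last_in_set[of u] by (auto simp: free_group_def)
    moreover have "butlast u = u \<otimes>\<^bsub>free_group A\<^esub> [inv_letter (last u)]"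
      using u(1) \<open>u \<noteq> []\<close> by (simp add: free_group_mult_letter)
    ultimately have "(P, ?Q) \<in> ?G"
      using a u inner_graph_free_quandle_letterI[of a A u "inv_letter (last u)"] by simp
    moreover have "?Q \<in> Y"
      using prefix[OF u(1)] Y by blast
    ultimately have "(P, ?Q) \<in> ?E"
      using P(1) less by auto
    with less show "\<exists>Q. (P, Q) \<in> ?E \<and> length (nf Q) < length (nf P)"
      by blast
  next
    fix P Q R
    assume E: "(P, Q) \<in> ?E" "(P, R) \<in> ?E"
      and le: "length (nf Q) \<le> length (nf P)" "length (nf R) \<le> length (nf P)"
    from E(1) have "P \<in> Y" by blast
    then obtain u where u: "u \<in> ?N" "P = fq_class A a u"
      using Y_cases by blast
    have "Q = fq_class A a (butlast u)"
      using edge_cases[OF u(1), of Q] E(1) le(1) nf_class[OF u(1)] u(2) by auto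
    moreover have "R = fq_class A a (butlast u)"
      using edge_cases[OF u(1), of R] E(2) le(2) nf_class[OF u(1)] u(2) by auto
    ultimately show "Q = R"
      by simp
  qed
qed

theorem proposition5p1:
  fixes A :: "'a set" and Y :: "'a fq set"
  assumes "finite A" and "card A > 1"
    and "Y \<in> quandle_components (free_quandle A) (fq_op A)"
  shows "\<exists>(V :: 'a fq set) E. tree V E \<and>
    quasi_isometric Y (inner_metric (free_quandle A) (fq_op A) (fq_gens A)) V (path_metric E)"
proof -
  let ?G = "inner_graph (free_quandle A) (fq_op A) (fq_gens A)"
  let ?E = "Restr ?G Y - Id"
  have A: "A \<noteq> {}"
    using assms(2) by auto
  interpret quandle "free_quandle A" "fq_op A" by (rule quandle_free_quandle[OF A])
  obtain a where "a \<in> A" "Y = fq_class A a ` carrier (free_group A)"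
    using component_free_quandle[OF A assms(3)] by blast
  then have "tree Y ?E"
    by (rule tree_component_free_quandle)
  moreover have "path_metric ?E P Q = path_metric ?G P Q" if "P \<in> Y" for P Q
    using component_closed_inner_graph[OF assms(3) fq_gens_Inn[OF A]] that
    by (rule path_metric_delete_loops)
  then have "quasi_isometric Y (inner_metric (free_quandle A) (fq_op A) (fq_gens A)) Y (path_metric ?E)"
    unfolding quasi_isometric_def inner_metric_def
    by (intro bexI[of _ "\<lambda>P. P"] exI[of _ "1::real"] exI[of _ "0::real"])
      (force simp: path_metric_refl)+
  ultimately show ?thesis
    by blast
qed

end
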